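(* There is no non-trivial cycle of length $8$ or less. There is no non-trivial cycle of length $11$ or less having exactly two runs (i.e., exactly two even terms in one period).
   Context: The subprime Fibonacci rule: from positive integers $x,y$ with $s=x+y$, the next term is $s$ if $s$ is prime and $s/p$ if $s$ is composite, where $p$ is the smallest prime factor of $s$. A non-trivial cycle of length $m$ is an $m$-tuple $(t_1,\dots,t_m)$ of positive integers, indices read modulo $m$, such that for every $i$, $t_i$ is obtained from $t_{i-2},t_{i-1}$ by this rule, the $t_i$ are not all equal, and $m$ is the minimal period. A run is a maximal block of consecutive odd terms together with the even term that follows it; the number of runs of a cycle is the number of even terms among $t_1,\dots,t_m$. *)

theory Defs
  imports Main "HOL-Computational_Algebra.Primes"
begin

text \<open>For positive arguments the sum is at least 2, so that ``not prime'' means ``composite'',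
  the set of prime factors is nonempty, and the division is exact.\<close>

definition subprime_next :: "nat \<Rightarrow> nat \<Rightarrow> nat" where
  "subprime_next x y =
     (let s = x + y in if prime s then s else s div Min (prime_factors s))"

text \<open>The tuple \<open>(t\<^sub>1, \<dots>, t\<^sub>m)\<close> is a list of length \<open>m\<close>, indexed from 0, with indices read
  modulo \<open>m\<close>. The third conjunct says that \<open>t\<^sub>i\<close> arises from \<open>t\<^bsub>i-2\<^esub>\<close> and \<open>t\<^bsub>i-1\<^esub>\<close>, shifted by 2 to
  avoid truncated subtraction. The last conjunct says that no \<open>d\<close> with \<open>0 < d < m\<close> is a period of
  the \<open>m\<close>-periodic sequence that the tuple generates.\<close>

definition nontrivial_cycle :: "nat \<Rightarrow> nat list \<Rightarrow> bool" where
  "nontrivial_cycle m t \<longleftrightarrow>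
     length t = m \<and>
     (\<forall>i<m. 0 < t ! i) \<and>
     (\<forall>i<m. t ! ((i + 2) mod m) = subprime_next (t ! i) (t ! ((i + 1) mod m))) \<and>
     (\<exists>i<m. \<exists>j<m. t ! i \<noteq> t ! j) \<and>
     (\<forall>d. 0 < d \<and> d < m \<longrightarrow> (\<exists>i<m. t ! ((i + d) mod m) \<noteq> t ! i))"

text \<open>Every run ends in exactly one even term, so runs are counted by their even terms.\<close>

definition num_runs :: "nat list \<Rightarrow> nat" where
  "num_runs t = card {i. i < length t \<and> even (t ! i)}"

end

theory Submission
  imports Defs
begin

text \<open>Unless the cycle is trivial, some term exceeds the mean of its two predecessors, so it is their
  sum and prime; this forces consecutive terms to be coprime. Hence even terms are isolated, every
  run has at least three terms, and within a run each term from the third on is the mean of its two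
  predecessors. A cycle of length at most 8 thus has one or two runs, and one run traversed twice
  counts as two. A cycle of two runs is, up to scaling, a positive fixed vector of a product of two
  \<open>2 \<times> 2\<close> matrices that depend on the run lengths and on four odd divisors (each 1 or a prime).
  These matrices have nonnegative entries that decrease in the divisors. So a finite search over
  lower bounds for the divisors, cut off where the spectral radius is certainly below or above 1,
  leaves only finitely many candidates, and each of them contains a term that the rule cannot
  produce.\<close>

section \<open>Searching for cycles with two runs\<close>

text \<open>Let \<open>a, b\<close> be the first two terms of a run. For suitable Jacobsthal numbers \<open>A, B\<close>, its last term is
  \<open>(A a + B b) / (A + B)\<close> and the sum of its last two terms is \<open>(B a + (2 A + B) b) / (A + B)\<close>.
  The first two terms \<open>a', b'\<close> of the next run arise from these by the divisors \<open>q, r\<close>.\<close>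

definition links :: "int \<times> int \<Rightarrow> int \<Rightarrow> int \<Rightarrow> int \<Rightarrow> int \<Rightarrow> int \<Rightarrow> int \<Rightarrow> bool" where
  "links = (\<lambda>(A, B) q r a b a' b'.
     (A + B) * q * a' = B * a + (2 * A + B) * b \<and>
     (A + B) * r * b' = A * a + B * b + (A + B) * a')"

text \<open>A divisor is known only up to a bound \<open>(l, e)\<close>: its reciprocal lies between \<open>e / l\<close> and \<open>1 / l\<close>.
  So \<open>e = 1\<close> means that it equals \<open>l\<close>, and \<open>e = 0\<close> that it is at least \<open>l\<close>.\<close>

definition within :: "int \<times> int \<Rightarrow> int \<Rightarrow> bool" where
  "within = (\<lambda>(l, e) q. odd l \<and> odd q \<and> 0 < l \<and> l \<le> q \<and> 0 \<le> e \<and> e * q \<le> l)"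

text \<open>The common denominator and the entries of the matrix that maps \<open>(a, b)\<close> to \<open>(a', b')\<close> when the
  reciprocals of the divisors are \<open>e / q\<close> and \<open>f / r\<close>.\<close>

definition step :: "int \<times> int \<Rightarrow> int \<times> int \<Rightarrow> int \<times> int \<Rightarrow> int \<times> int \<times> int \<times> int \<times> int" where
  "step = (\<lambda>(A, B) (q, e) (r, f).
     ((A + B) * q * r, e * r * B, e * r * (2 * A + B),
      f * (q * A + e * B), f * (q * B + e * (2 * A + B))))"

definition transfer ::
    "int \<times> int \<Rightarrow> int \<times> int \<Rightarrow> (int \<times> int) list \<Rightarrow> int \<times> int \<times> int \<times> int \<times> int" where
  "transfer c c' bs =
     (let (d, m11, m12, m21, m22) = step c (bs ! 0) (bs ! 1);
          (d', n11, n12, n21, n22) = step c' (bs ! 2) (bs ! 3)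
      in (d * d', n11 * m11 + n12 * m21, n11 * m12 + n12 * m22,
          n21 * m11 + n22 * m21, n21 * m12 + n22 * m22))"

text \<open>The characteristic polynomial at 1 of the transfer matrix, cleared of denominators. The
  determinant of a step matrix contains its denominator as a factor, which is cancelled here; this
  makes the value linear in every pair \<open>(l, e)\<close>.\<close>

definition charp :: "int \<times> int \<Rightarrow> int \<times> int \<Rightarrow> (int \<times> int) list \<Rightarrow> int" where
  "charp c c' bs =
     (let (d, x11, x12, x21, x22) = transfer c c' bs
      in d - x11 - x22 + (snd c - 2 * fst c) * (snd c' - 2 * fst c') * prod_list (map snd bs))"

definition shrinks :: "int \<times> int \<Rightarrow> int \<times> int \<Rightarrow> (int \<times> int) list \<Rightarrow> bool" where
  "shrinks c c' bs =
     (let cs = map (\<lambda>(l, e). (l, 1)) bs; (d, x11, x12, x21, x22) = transfer c c' cs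
      in x11 < d \<and> x22 < d \<and> 0 < charp c c' cs)"

definition grows :: "int \<times> int \<Rightarrow> int \<times> int \<Rightarrow> (int \<times> int) list \<Rightarrow> bool" where
  "grows c c' bs =
     (let (d, x11, x12, x21, x22) = transfer c c' bs
      in d < x11 \<or> d < x22 \<or> charp c c' bs < 0)"

text \<open>No term is 1, a prime divisor is at most the cofactor that it leaves, and a term obtained
  without division is prime. Divisibility by 3 and 7 is all that the search needs of the latter.\<close>

definition illegal :: "int \<Rightarrow> int \<Rightarrow> bool" where
  "illegal q x \<longleftrightarrow> x \<le> 1 \<or> x < q \<or> q = 1 \<and> (3 < x \<and> 3 dvd x \<or> 7 < x \<and> 7 dvd x)"

text \<open>When all divisors are known, the eigenvector \<open>(a, b)\<close> is determined by being coprime.\<close>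

definition refuted :: "int \<times> int \<Rightarrow> int \<times> int \<Rightarrow> (int \<times> int) list \<Rightarrow> bool" where
  "refuted c c' bs =
     (let (d, x11, x12, x21, x22) = transfer c c' bs;
          g = gcd x12 (d - x11); a = x12 div g; b = (d - x11) div g; (A, B) = c;
          a' = (B * a + (2 * A + B) * b) div ((A + B) * fst (bs ! 0));
          b' = (A * a + B * b + (A + B) * a') div ((A + B) * fst (bs ! 1))
      in d \<le> x11 \<or> illegal (fst (bs ! 0)) a' \<or> illegal (fst (bs ! 1)) b' \<or>
         illegal (fst (bs ! 2)) a \<or> illegal (fst (bs ! 3)) b)"

definition solved :: "int \<times> int \<Rightarrow> int \<times> int \<Rightarrow> (int \<times> int) list \<Rightarrow> nat \<Rightarrow> bool" where
  "solved c c' bs i =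
     (let u = charp c c' (bs[i := (1, 0)]); v = charp c c' (bs[i := (0, 1)])
      in if u = 0 then v \<noteq> 0 else if u dvd v then refuted c c' (bs[i := (- v div u, 1)]) else True)"

text \<open>The smallest undetermined divisor \<open>l\<close> is either \<open>l\<close> or, being odd, at least \<open>l + 2\<close>. The last
  one is found by solving the characteristic equation. The code simplifier evaluates conditionals
  lazily, but not disjunctions.\<close>

fun search :: "nat \<Rightarrow> int \<times> int \<Rightarrow> int \<times> int \<Rightarrow> (int \<times> int) list \<Rightarrow> bool" where
  "search 0 c c' bs = False"
| "search (Suc k) c c' bs \<longleftrightarrow>
     (case filter (\<lambda>i. snd (bs ! i) = 0) [0, 1, 2, 3] of
       [] \<Rightarrow> False
     | [i] \<Rightarrow> solved c c' bs i
     | is \<Rightarrow> if shrinks c c' bs then True else if grows c c' bs then True else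
         (let i = arg_min_list (\<lambda>i. fst (bs ! i)) is; l = fst (bs ! i)
          in search k c c' (bs[i := (l, 1)]) \<and> search k c c' (bs[i := (l + 2, 0)])))"

section \<open>Determinant, linearity and monotonicity of the transfer matrices\<close>

lemma step_det:
  assumes "step (A, B) (q, e) (r, f) = (d, m11, m12, m21, m22)"
  shows "m11 * m22 - m12 * m21 = d * ((B - 2 * A) * e * f)"
  using assms by (auto simp: step_def algebra_simps)

text \<open>Both step determinants are multiples of their denominators, so the determinant of the
  product is a multiple of \<open>d\<close>; the cofactor \<open>p\<close> is the last summand of
  \<open>charp\<close>.\<close>

lemma charp_det:
  assumes "length bs = 4" "transfer c c' bs = (d, x11, x12, x21, x22)"
  shows "d * charp c c' bs = (d - x11) * (d - x22) - x12 * x21"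
proof -
  obtain A B A' B' where c: "c = (A, B)" "c' = (A', B')" by (cases c, cases c') auto
  obtain q e r f q' e' r' f' where bs: "bs = [(q, e), (r, f), (q', e'), (r', f')]"
    using assms(1) by (auto simp: length_Suc_conv numeral_eq_Suc)
  obtain k m11 m12 m21 m22 where m: "step (A, B) (q, e) (r, f) = (k, m11, m12, m21, m22)"
    by (metis prod_cases5)
  obtain k' n11 n12 n21 n22 where n: "step (A', B') (q', e') (r', f') = (k', n11, n12, n21, n22)"
    by (metis prod_cases5)
  have t: "d = k * k'" "x11 = n11 * m11 + n12 * m21" "x12 = n11 * m12 + n12 * m22"
    "x21 = n21 * m11 + n22 * m21" "x22 = n21 * m12 + n22 * m22"
    using assms(2) by (auto simp: transfer_def c bs m n)
  define p where "p = (B - 2 * A) * (B' - 2 * A') * (e * (f * (e' * f')))"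
  have p: "charp c c' bs = d - x11 - x22 + p"
    unfolding charp_def assms(2) by (simp add: c bs p_def)
  have "x11 * x22 - x12 * x21 = (n11 * n22 - n12 * n21) * (m11 * m22 - m12 * m21)"
    unfolding t by (simp add: algebra_simps)
  also have "\<dots> = d * p"
    unfolding step_det[OF m] step_det[OF n] t(1) p_def by (simp add: ac_simps)
  finally show ?thesis
    unfolding p by (simp add: algebra_simps)
qed

text \<open>Each pair enters linearly, and \<open>(x, 1)\<close> is
  \<open>x * (1, 0) + (0, 1)\<close>. The last unknown divisor thus solves a linear
  equation.\<close>

lemma charp_affine:
  assumes "length bs = 4" "i < 4"
  shows "charp c c' (bs[i := (x, 1)]) =
    x * charp c c' (bs[i := (1, 0)]) + charp c c' (bs[i := (0, 1)])"
proof -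
  obtain A B A' B' where c: "c = (A, B)" "c' = (A', B')" by (cases c, cases c') auto
  obtain q e r f q' e' r' f' where bs: "bs = [(q, e), (r, f), (q', e'), (r', f')]"
    using assms(1) by (auto simp: length_Suc_conv numeral_eq_Suc)
  have "i = 0 \<or> i = 1 \<or> i = 2 \<or> i = 3" using assms(2) by linarith
  then show ?thesis
    by (elim disjE) (simp_all add: c bs charp_def transfer_def step_def algebra_simps)
qed

lemma within_fixed:
  assumes "within (l, e) q" "e \<noteq> 0"
  shows "l = q \<and> e = 1"
proof -
  have q: "0 < q" "l \<le> q" "e * q \<le> l" "1 \<le> e" using assms by (auto simp: within_def)
  then have "e * q \<le> 1 * q" by linarith
  then have "e = 1" using q by (simp only: mult_le_cancel_right) auto
  then show ?thesis using q by auto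
qed

lemma within_split:
  assumes "within (l, e) q" "e = 0"
  shows "within (l, 1) q \<or> within (l + 2, 0) q"
proof (cases "q = l")
  case False
  then have "l + 2 \<le> q" using assms by (auto simp: within_def) presburger
  then show ?thesis using assms by (auto simp: within_def)
qed (use assms in \<open>auto simp: within_def\<close>)

text \<open>Lower bounds on the divisors overestimate the new terms. The bound on \<open>b'\<close>
  uses the one on \<open>a'\<close>, which is a summand in the equation for
  \<open>b'\<close>.\<close>

lemma links_le:
  assumes "links (A, B) q r a b a' b'" "step (A, B) (l, 1) (l', 1) = (d, m11, m12, m21, m22)"
    and "0 < A" "0 < B" "0 < a'" "0 < b'" "0 < l" "l \<le> q" "0 < l'" "l' \<le> r"
  shows "d * a' \<le> m11 * a + m12 * b" "d * b' \<le> m21 * a + m22 * b"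
proof -
  have e: "(A + B) * q * a' = B * a + (2 * A + B) * b" "(A + B) * r * b' = A * a + B * b + (A + B) * a'"
    using assms(1) by (auto simp: links_def)
  have "(A + B) * l * a' \<le> (A + B) * q * a'" using assms by (simp add: mult_left_mono)
  then have 1: "(A + B) * l * a' \<le> B * a + (2 * A + B) * b" unfolding e .
  have "(A + B) * l' * b' \<le> (A + B) * r * b'" using assms by (simp add: mult_left_mono)
  then have 2: "(A + B) * l' * b' \<le> A * a + B * b + (A + B) * a'" unfolding e .
  show "d * a' \<le> m11 * a + m12 * b"
    using mult_left_mono[OF 1, of l'] assms(2,9) by (auto simp: step_def algebra_simps)
  show "d * b' \<le> m21 * a + m22 * b"
    using mult_left_mono[OF 2, of l] 1 assms(2,7) by (auto simp: step_def algebra_simps)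
qed

text \<open>The opposite estimate: \<open>e / l\<close> and \<open>e' / l'\<close> are at most the
  true reciprocals.\<close>

lemma links_ge:
  assumes "links (A, B) q r a b a' b'" "step (A, B) (l, e) (l', e') = (d, m11, m12, m21, m22)"
    and "0 < A" "0 < B" "0 < a'" "0 < b'" "0 < l" "e * q \<le> l" "0 < l'" "e' * r \<le> l'" "0 \<le> e'"
  shows "m11 * a + m12 * b \<le> d * a'" "m21 * a + m22 * b \<le> d * b'"
proof -
  have e: "(A + B) * q * a' = B * a + (2 * A + B) * b" "(A + B) * r * b' = A * a + B * b + (A + B) * a'"
    using assms(1) by (auto simp: links_def)
  have "(A + B) * a' * (e * q) \<le> (A + B) * a' * l"
    using assms by (intro mult_left_mono) auto
  then have 1: "e * ((A + B) * q * a') \<le> (A + B) * l * a'" by (simp add: algebra_simps)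
  have "(A + B) * b' * (e' * r) \<le> (A + B) * b' * l'"
    using assms by (intro mult_left_mono) auto
  then have 2: "e' * ((A + B) * r * b') \<le> (A + B) * l' * b'" by (simp add: algebra_simps)
  show "m11 * a + m12 * b \<le> d * a'"
    using mult_left_mono[OF 1, of l'] assms(2,9) unfolding e by (auto simp: step_def algebra_simps)
  show "m21 * a + m22 * b \<le> d * b'"
    using mult_left_mono[OF 2, of l] mult_left_mono[OF 1, of e'] assms(2,7,11) unfolding e
    by (auto simp: step_def algebra_simps)
qed

lemma step_nonneg:
  assumes "step (A, B) (l, e) (l', e') = (d, m11, m12, m21, m22)"
    and "0 < A" "0 < B" "0 < l" "0 < l'" "0 \<le> e" "0 \<le> e'"
  shows "0 < d" "0 \<le> m11" "0 \<le> m12" "0 \<le> m21" "0 \<le> m22"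
  using assms by (auto simp: step_def)

text \<open>\<open>a\<close> divides \<open>b * v\<close>, hence \<open>v\<close>, and the cofactor
  is \<open>gcd v u\<close>. This recovers an eigenvector from one row of its equation.\<close>

lemma coprime_ratio:
  fixes a b u v :: int
  assumes "coprime a b" "a * u = b * v" "0 < a" "0 < b" "0 < u"
  shows "a = v div gcd v u" "b = u div gcd v u"
proof -
  have "a dvd v" using assms by (metis coprime_dvd_mult_right_iff dvd_triv_left)
  then obtain k where k: "v = k * a" by (metis dvd_def mult.commute)
  then have u: "u = k * b" using assms by auto
  have "0 < k" using assms(4,5) unfolding u by (simp add: zero_less_mult_iff)
  have "gcd v u = k"
    using assms(1) \<open>0 < k\<close> unfolding k u by (simp flip: gcd_mult_distrib_int)
  then show "a = v div gcd v u" "b = u div gcd v u"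
    using \<open>0 < k\<close> k u by auto
qed

text \<open>The divisors \<open>q\<close>, \<open>r\<close> produce \<open>a'\<close>,
  \<open>b'\<close>, while \<open>q'\<close>, \<open>r'\<close> lead back to \<open>a\<close>,
  \<open>b\<close>; hence the crosswise pairing in \<open>legal\<close>.\<close>

locale two_run_cycle =
  fixes A B A' B' q r q' r' a b a' b' :: int
  assumes coeffs_pos: "0 < A" "0 < B" "0 < A'" "0 < B'"
    and divisors: "0 < q" "0 < r" "0 < q'" "0 < r'" "odd q" "odd r" "odd q'" "odd r'"
    and legal: "\<not> illegal q a'" "\<not> illegal r b'" "\<not> illegal q' a" "\<not> illegal r' b"
    and coprime: "coprime a b"
    and links: "links (A, B) q r a b a' b'" "links (A', B') q' r' a' b' a b"
begin

section \<open>Soundness of the search\<close>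

abbreviation charpoly where "charpoly \<equiv> charp (A, B) (A', B')"

lemma pos: "0 < a" "0 < b" "0 < a'" "0 < b'"
  using legal by (auto simp: illegal_def)

text \<open>The two one-step estimates compose because the second matrix has nonnegative
  entries.\<close>

lemma transfer_ge:
  assumes "list_all2 within bs [q, r, q', r']"
    and "transfer (A, B) (A', B') (map (\<lambda>(l, e). (l, 1)) bs) = (d, x11, x12, x21, x22)"
  shows "d * a \<le> x11 * a + x12 * b" "d * b \<le> x21 * a + x22 * b"
proof -
  obtain l1 e1 l2 e2 l3 e3 l4 e4 where bs: "bs = [(l1, e1), (l2, e2), (l3, e3), (l4, e4)]"
    using assms(1) by (auto simp: list_all2_Cons2)
  have l: "0 < l1" "l1 \<le> q" "0 < l2" "l2 \<le> r" "0 < l3" "l3 \<le> q'" "0 < l4" "l4 \<le> r'"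
    using assms(1) by (auto simp: bs within_def)
  obtain k m11 m12 m21 m22 where m: "step (A, B) (l1, 1) (l2, 1) = (k, m11, m12, m21, m22)"
    by (metis prod_cases5)
  obtain k' n11 n12 n21 n22 where n: "step (A', B') (l3, 1) (l4, 1) = (k', n11, n12, n21, n22)"
    by (metis prod_cases5)
  have t: "d = k * k'" "x11 = n11 * m11 + n12 * m21" "x12 = n11 * m12 + n12 * m22"
    "x21 = n21 * m11 + n22 * m21" "x22 = n21 * m12 + n22 * m22"
    using assms(2) by (auto simp: transfer_def bs m n)
  note m_le = links_le[OF links(1) m coeffs_pos(1,2) pos(3,4) l(1-4)]
  note n_le = links_le[OF links(2) n coeffs_pos(3,4) pos(1,2) l(5-8)]
  note m_pos = step_nonneg[OF m coeffs_pos(1,2) l(1,3)]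
  note n_pos = step_nonneg[OF n coeffs_pos(3,4) l(5,7)]
  have "k * (k' * a) \<le> k * (n11 * a' + n12 * b')" "k * (k' * b) \<le> k * (n21 * a' + n22 * b')"
    using n_le m_pos by (auto intro!: mult_left_mono)
  moreover have "n11 * (k * a') \<le> n11 * (m11 * a + m12 * b)"
    "n12 * (k * b') \<le> n12 * (m21 * a + m22 * b)"
    "n21 * (k * a') \<le> n21 * (m11 * a + m12 * b)"
    "n22 * (k * b') \<le> n22 * (m21 * a + m22 * b)"
    using m_le n_pos by (auto intro!: mult_left_mono)
  ultimately show "d * a \<le> x11 * a + x12 * b" "d * b \<le> x21 * a + x22 * b"
    unfolding t by (simp_all add: algebra_simps)
qed

lemma transfer_le:
  assumes "list_all2 within bs [q, r, q', r']"
    and "transfer (A, B) (A', B') bs = (d, x11, x12, x21, x22)"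
  shows "x11 * a + x12 * b \<le> d * a" "x21 * a + x22 * b \<le> d * b" "0 < d" "0 \<le> x12" "0 \<le> x21"
proof -
  obtain l1 e1 l2 e2 l3 e3 l4 e4 where bs: "bs = [(l1, e1), (l2, e2), (l3, e3), (l4, e4)]"
    using assms(1) by (auto simp: list_all2_Cons2)
  have l: "0 < l1" "e1 * q \<le> l1" "0 < l2" "e2 * r \<le> l2" "0 < l3" "e3 * q' \<le> l3"
    "0 < l4" "e4 * r' \<le> l4" "0 \<le> e1" "0 \<le> e2" "0 \<le> e3" "0 \<le> e4"
    using assms(1) by (auto simp: bs within_def)
  obtain k m11 m12 m21 m22 where m: "step (A, B) (l1, e1) (l2, e2) = (k, m11, m12, m21, m22)"
    by (metis prod_cases5)
  obtain k' n11 n12 n21 n22 where n: "step (A', B') (l3, e3) (l4, e4) = (k', n11, n12, n21, n22)"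
    by (metis prod_cases5)
  have t: "d = k * k'" "x11 = n11 * m11 + n12 * m21" "x12 = n11 * m12 + n12 * m22"
    "x21 = n21 * m11 + n22 * m21" "x22 = n21 * m12 + n22 * m22"
    using assms(2) by (auto simp: transfer_def bs m n)
  note m_ge = links_ge[OF links(1) m coeffs_pos(1,2) pos(3,4) l(1-4,10)]
  note n_ge = links_ge[OF links(2) n coeffs_pos(3,4) pos(1,2) l(5-8,12)]
  note m_pos = step_nonneg[OF m coeffs_pos(1,2) l(1,3,9,10)]
  note n_pos = step_nonneg[OF n coeffs_pos(3,4) l(5,7,11,12)]
  have "k * (k' * a) \<ge> k * (n11 * a' + n12 * b')" "k * (k' * b) \<ge> k * (n21 * a' + n22 * b')"
    using n_ge m_pos by (auto intro!: mult_left_mono)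
  moreover have "n11 * (k * a') \<ge> n11 * (m11 * a + m12 * b)"
    "n12 * (k * b') \<ge> n12 * (m21 * a + m22 * b)"
    "n21 * (k * a') \<ge> n21 * (m11 * a + m12 * b)"
    "n22 * (k * b') \<ge> n22 * (m21 * a + m22 * b)"
    using m_ge n_pos by (auto intro!: mult_left_mono)
  ultimately show "x11 * a + x12 * b \<le> d * a" "x21 * a + x22 * b \<le> d * b"
    unfolding t by (simp_all add: algebra_simps)
  show "0 < d" "0 \<le> x12" "0 \<le> x21" unfolding t using m_pos n_pos by simp_all
qed

text \<open>A positive vector that a nonnegative matrix does not decrease excludes a spectral radius
  below 1. Concretely, if both diagonal entries are below \<open>d\<close>, the product of the two
  row inequalities makes \<open>charp\<close> nonpositive.\<close>

lemma not_shrinks: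
  assumes bs: "list_all2 within bs [q, r, q', r']"
  shows "\<not> shrinks (A, B) (A', B') bs"
proof
  assume s: "shrinks (A, B) (A', B') bs"
  define cs where "cs = map (\<lambda>(l, e :: int). (l, 1 :: int)) bs"
  obtain d x11 x12 x21 x22 where t: "transfer (A, B) (A', B') cs = (d, x11, x12, x21, x22)"
    by (metis prod_cases5)
  have x: "x11 < d" "x22 < d" "0 < charpoly cs"
    using s t by (auto simp: shrinks_def cs_def[symmetric])
  note le = transfer_ge[OF bs t[unfolded cs_def]]
  have len: "length cs = 4" using list_all2_lengthD[OF bs] by (simp add: cs_def)
  have le': "(d - x11) * a \<le> x12 * b" "(d - x22) * b \<le> x21 * a"
    using le by (simp_all add: algebra_simps)
  have "0 < (d - x11) * a" using x pos by simp
  then have "0 < x12" using le' pos by (smt (verit) zero_less_mult_iff)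
  have "0 < d"
  proof -
    obtain l1 e1 l2 e2 l3 e3 l4 e4 where "bs = [(l1, e1), (l2, e2), (l3, e3), (l4, e4)]"
      using bs by (auto simp: list_all2_Cons2)
    then show ?thesis
      using bs t coeffs_pos by (auto simp: cs_def transfer_def step_def within_def)
  qed
  have "(d - x11) * a * ((d - x22) * b) \<le> x12 * b * (x21 * a)"
    using x pos \<open>0 < x12\<close> by (intro mult_mono[OF le']) simp_all
  then have "((d - x11) * (d - x22) - x12 * x21) * (a * b) \<le> 0"
    by (simp add: algebra_simps)
  then have "d * charpoly cs * (a * b) \<le> 0"
    unfolding charp_det[OF len t] .
  moreover have "0 < d * charpoly cs * (a * b)"
    using \<open>0 < d\<close> x pos by simp
  ultimately show False by simp
qed

text \<open>The dual argument for the underestimating matrix: its nonnegative off-diagonal entries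
  force \<open>x11\<close> and \<open>x22\<close> to be at most \<open>d\<close>, and the product of
  the row inequalities then makes \<open>charp\<close> nonnegative.\<close>

lemma not_grows:
  assumes bs: "list_all2 within bs [q, r, q', r']"
  shows "\<not> grows (A, B) (A', B') bs"
proof
  assume g: "grows (A, B) (A', B') bs"
  obtain d x11 x12 x21 x22 where t: "transfer (A, B) (A', B') bs = (d, x11, x12, x21, x22)"
    by (metis prod_cases5)
  note le = transfer_le[OF bs t]
  have len: "length bs = 4" using list_all2_lengthD[OF bs] by simp
  have le': "x12 * b \<le> (d - x11) * a" "x21 * a \<le> (d - x22) * b"
    using le by (simp_all add: algebra_simps)
  have "0 \<le> x12 * b" "0 \<le> x21 * a" using le pos by simp_all
  then have "0 \<le> (d - x11) * a" "0 \<le> (d - x22) * b" using le' by linarith+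
  then have d: "x11 \<le> d" "x22 \<le> d" using pos by (simp_all add: zero_le_mult_iff)
  then have "charpoly bs < 0" using g t by (auto simp: grows_def)
  have "x12 * b * (x21 * a) \<le> (d - x11) * a * ((d - x22) * b)"
    using le d pos by (intro mult_mono[OF le']) simp_all
  then have "0 \<le> ((d - x11) * (d - x22) - x12 * x21) * (a * b)"
    by (simp add: algebra_simps)
  then have "0 \<le> d * charpoly bs * (a * b)"
    unfolding charp_det[OF len t] .
  moreover have "d * charpoly bs * (a * b) < 0"
    using le(3) \<open>charpoly bs < 0\<close> pos by (simp add: mult_pos_neg mult_neg_pos)
  ultimately show False by simp
qed

abbreviation exact :: "(int \<times> int) list" where "exact \<equiv> [(q, 1), (r, 1), (q', 1), (r', 1)]"

lemma exact_within: "list_all2 within exact [q, r, q', r']"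
  using divisors by (auto simp: within_def)

text \<open>With all divisors known, the upper and lower estimates coincide, so
  \<open>(a, b)\<close> is a fixed vector.\<close>

lemma charpoly_exact: "charpoly exact = 0"
proof -
  obtain d x11 x12 x21 x22 where t: "transfer (A, B) (A', B') exact = (d, x11, x12, x21, x22)"
    by (metis prod_cases5)
  have "(d - x11) * a = x12 * b" "(d - x22) * b = x21 * a"
    using transfer_le[OF exact_within t] transfer_ge[OF exact_within, of d x11 x12 x21 x22] t
    by (auto simp: algebra_simps)
  then have "(d - x11) * a * ((d - x22) * b) = x12 * b * (x21 * a)" by simp
  then have "((d - x11) * (d - x22) - x12 * x21) * (a * b) = 0"
    by (simp add: algebra_simps)
  then have "d * charpoly exact * (a * b) = 0"
    by (subst charp_det[OF _ t]) simp_all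
  then show ?thesis
    using transfer_le(3)[OF exact_within t] pos by simp
qed

text \<open>The first row and coprimality give back \<open>(a, b)\<close>, and the links give back
  \<open>(a', b')\<close>. So \<open>refuted\<close> tests the actual terms, which are
  legal.\<close>

lemma not_refuted: "\<not> refuted (A, B) (A', B') exact"
proof -
  obtain d x11 x12 x21 x22 where t: "transfer (A, B) (A', B') exact = (d, x11, x12, x21, x22)"
    by (metis prod_cases5)
  have x: "a * (d - x11) = b * x12"
    using transfer_le[OF exact_within t] transfer_ge[OF exact_within, of d x11 x12 x21 x22] t
    by (auto simp: algebra_simps)
  have "0 < x12"
    using t coeffs_pos divisors by (auto simp: transfer_def step_def intro!: add_pos_pos mult_pos_pos)
  then have "0 < a * (d - x11)" using pos unfolding x by simp
  then have d: "x11 < d" using pos by (simp add: zero_less_mult_iff)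
  then have ab: "x12 div gcd x12 (d - x11) = a" "(d - x11) div gcd x12 (d - x11) = b"
    using coprime_ratio[OF coprime x pos(1,2)] by simp_all
  have "B * a + (2 * A + B) * b = (A + B) * q * a'" using links(1) by (simp add: links_def)
  then have a': "(B * a + (2 * A + B) * b) div ((A + B) * q) = a'"
    using coeffs_pos divisors by simp
  have "A * a + B * b + (A + B) * a' = (A + B) * r * b'" using links(1) by (simp add: links_def)
  then have b': "(A * a + B * b + (A + B) * a') div ((A + B) * r) = b'"
    using coeffs_pos divisors by simp
  show ?thesis
    unfolding refuted_def t using d legal by (simp add: ab a' b' Let_def)
qed

text \<open>Inserting the true divisor \<open>x\<close> at \<open>i\<close> gives
  \<open>exact\<close>, so \<open>x * u + v = 0\<close>. Either \<open>u = v = 0\<close> or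
  \<open>x = - v div u\<close>; neither lets \<open>solved\<close> succeed.\<close>

lemma not_solved:
  assumes bs: "list_all2 within bs [q, r, q', r']" and i: "i < 4"
    and fixed: "\<And>j. j < 4 \<Longrightarrow> j \<noteq> i \<Longrightarrow> snd (bs ! j) \<noteq> 0"
  shows "\<not> solved (A, B) (A', B') bs i"
proof
  assume s: "solved (A, B) (A', B') bs i"
  define x where "x = [q, r, q', r'] ! i"
  have len: "length bs = 4" using list_all2_lengthD[OF bs] by simp
  have exact: "bs[i := (x, 1)] = exact"
  proof (rule nth_equalityI)
    fix j assume "j < length (bs[i := (x, 1)])"
    then have j: "j < 4" using len by simp
    have e: "exact ! j = ([q, r, q', r'] ! j, 1)"
      using j by (auto simp: less_Suc_eq numeral_eq_Suc)
    show "bs[i := (x, 1)] ! j = exact ! j"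
    proof (cases "j = i")
      case False
      have "within (fst (bs ! j), snd (bs ! j)) ([q, r, q', r'] ! j)"
        using list_all2_nthD[OF bs, of j] j len by simp
      then have "bs ! j = ([q, r, q', r'] ! j, 1)"
        using within_fixed fixed[OF j False] by (metis prod.collapse)
      then show ?thesis unfolding e using False by simp
    qed (use e j len in \<open>auto simp: x_def\<close>)
  qed (use len in simp)
  define u v where "u = charpoly (bs[i := (1, 0)])" "v = charpoly (bs[i := (0, 1)])"
  have xuv: "x * u + v = 0"
    using charp_affine[OF len i, of "(A, B)" "(A', B')" x] charpoly_exact
    by (simp add: exact u_v_def)
  show False
  proof (cases "u = 0")
    case False
    have "- v = x * u" using xuv by linarith
    then have "u dvd v" "- v div u = x"
      using False by (metis dvd_minus_iff dvd_triv_right, simp)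
    then show False
      using s False not_refuted exact by (simp add: solved_def u_v_def[symmetric])
  qed (use s xuv in \<open>auto simp: solved_def u_v_def\<close>)
qed

text \<open>The invariant is that the bounds admit the true divisors. One branch of each split
  preserves it, and no closing test succeeds under it.\<close>

lemma not_search:
  "list_all2 within bs [q, r, q', r'] \<Longrightarrow> \<not> search k (A, B) (A', B') bs"
proof (induction k arbitrary: bs)
  case (Suc k)
  note bs = Suc.prems
  have len: "length bs = 4" using list_all2_lengthD[OF bs] by simp
  define free where "free = filter (\<lambda>i. snd (bs ! i) = 0) [0, 1, 2, 3]"
  have set_free: "set free = {i. i < 4 \<and> snd (bs ! i) = 0}"
  proof -
    have "set [0, 1, 2, 3] = {..<4 :: nat}" by (auto simp: numeral_eq_Suc less_Suc_eq)
    then show ?thesis unfolding free_def set_filter by blast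
  qed
  show ?case
  proof (cases free)
    case Nil
    then show ?thesis by (simp add: free_def)
  next
    case (Cons i js)
    show ?thesis
    proof (cases js)
      case Nil
      then have "set free = {i}" using Cons by simp
      then have "\<not> solved (A, B) (A', B') bs i"
        using set_free by (intro not_solved[OF bs]) auto
      then show ?thesis using Cons Nil by (simp add: free_def)
    next
      case (Cons j ks)
      define m where "m = arg_min_list (\<lambda>i. fst (bs ! i)) free"
      define l where "l = fst (bs ! m)"
      have "m \<in> set free" unfolding m_def by (rule arg_min_list_in) (simp add: \<open>free = i # js\<close>)
      then have m: "m < 4" "snd (bs ! m) = 0" using set_free by auto
      have "within (l, snd (bs ! m)) ([q, r, q', r'] ! m)"
        using list_all2_nthD[OF bs, of m] m(1) len by (simp add: l_def)
      then have "within (l, 1) ([q, r, q', r'] ! m) \<or> within (l + 2, 0) ([q, r, q', r'] ! m)"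
        using within_split m by blast
      then have "list_all2 within (bs[m := (l, 1)]) [q, r, q', r'] \<or>
          list_all2 within (bs[m := (l + 2, 0)]) [q, r, q', r']"
        using list_all2_update_cong[OF bs, of _ "[q, r, q', r'] ! m" m]
        by (metis list_update_id)
      then have "\<not> (search k (A, B) (A', B') (bs[m := (l, 1)]) \<and>
          search k (A, B) (A', B') (bs[m := (l + 2, 0)]))"
        using Suc.IH by blast
      moreover have "search (Suc k) (A, B) (A', B') bs \<longleftrightarrow>
          (if shrinks (A, B) (A', B') bs then True else if grows (A, B) (A', B') bs then True else
           search k (A, B) (A', B') (bs[m := (l, 1)]) \<and>
           search k (A, B) (A', B') (bs[m := (l + 2, 0)]))"
        by (simp only: search.simps free_def[symmetric] \<open>free = i # js\<close> Cons list.case m_def l_def Let_def)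
      ultimately show ?thesis
        using not_shrinks[OF bs] not_grows[OF bs] by auto
    qed
  qed
qed simp

end

section \<open>The finite computation for run lengths 3 to 8\<close>

definition run_coeffs :: "(int \<times> int) list" where
  "run_coeffs = [(1, 1), (1, 3), (3, 5), (5, 11), (11, 21), (21, 43)]"

text \<open>Initially \<open>(1, 0)\<close> only says that a divisor is odd and at least 1; 30
  limits the recursion depth.\<close>

lemma search_run_coeffs:
  "list_all (\<lambda>c. list_all (\<lambda>c'. search 30 c c' (replicate 4 (1, 0))) run_coeffs) run_coeffs"
  by code_simp

lemma (in two_run_cycle) not_run_coeffs:
  assumes "(A, B) \<in> set run_coeffs" "(A', B') \<in> set run_coeffs"
  shows False
proof -
  have "list_all2 within (replicate 4 (1, 0)) [q, r, q', r']"
    using divisors by (auto simp: numeral_eq_Suc within_def)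
  then have "\<not> search 30 (A, B) (A', B') (replicate 4 (1, 0))"
    by (rule not_search)
  then show False
    using search_run_coeffs assms unfolding list_all_iff by blast
qed

section \<open>Periodic sequences of the subprime rule\<close>

text \<open>For composite \<open>s\<close>, the cofactor of the smallest prime factor
  \<open>q\<close> has a prime factor, which also divides \<open>s\<close> and so is at least
  \<open>q\<close>.\<close>

lemma subprime_next_divisor:
  assumes "0 < x" "0 < y"
  shows "\<exists>q. q * subprime_next x y = x + y \<and>
    (q = 1 \<and> prime (subprime_next x y) \<or> prime q \<and> q \<le> subprime_next x y) \<and>
    (even (x + y) \<and> x + y \<noteq> 2 \<longrightarrow> q = 2)"
proof (cases "prime (x + y)")
  case True
  then have "even (x + y) \<Longrightarrow> x + y = 2"
    by (metis prime_nat_iff numeral_eq_one_iff semiring_norm(85))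
  then show ?thesis
    using True by (intro exI[of _ 1]) (auto simp: subprime_next_def)
next
  case False
  define s where "s = x + y"
  define q where "q = Min (prime_factors s)"
  have s: "1 < s" using assms by (simp add: s_def)
  then obtain p where "prime p" "p dvd s" using prime_factor_nat[of s] by auto
  then have "prime_factors s \<noteq> {}" using s by (auto simp: prime_factors_dvd)
  then have "q \<in> prime_factors s" unfolding q_def by (intro Min_in) auto
  then have q: "prime q" "q dvd s" by auto
  have q_le: "q \<le> p" if "prime p" "p dvd s" for p
    unfolding q_def using that s by (intro Min_le) (auto simp: prime_factors_dvd)
  have step: "subprime_next x y = s div q"
    using False by (simp add: subprime_next_def s_def q_def Let_def)
  have mult: "q * (s div q) = s" using q by simp
  then have "s div q \<noteq> 1" using q False by (metis mult.right_neutral s_def)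
  then obtain p where p: "prime p" "p dvd s div q" using prime_factor_nat by blast
  then have "p dvd s" using mult by (metis dvd_mult)
  have "0 < s div q" using mult s by (metis gr0I mult_0_right not_less_zero)
  then have "q \<le> s div q"
    using q_le[OF p(1) \<open>p dvd s\<close>] dvd_imp_le[OF p(2)] by linarith
  moreover have "even s \<Longrightarrow> q = 2"
    using q_le[OF two_is_prime_nat] prime_ge_2_nat[OF q(1)] by linarith
  ultimately show ?thesis
    using q mult by (intro exI[of _ q]) (simp add: step s_def)
qed

locale subprime_cycle =
  fixes s :: "nat \<Rightarrow> nat" and m :: nat
  assumes period: "0 < m" "\<And>i. s (i + m) = s i"
    and pos: "\<And>i. 0 < s i"
    and recurrence: "\<And>i. s (i + 2) = subprime_next (s i) (s (i + 1))"
    and nonconstant: "\<exists>i j. s i \<noteq> s j"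
begin

lemma period_mult: "s (i + k * m) = s i"
  by (induction k) (simp_all add: period add.assoc[symmetric] add.commute[of m])

lemma period_mod: "s (i mod m) = s i"
  by (metis period_mult mod_div_mult_eq)

text \<open>Whole periods lead from \<open>i\<close> to an index beyond \<open>j\<close>, from which
  the backward step descends.\<close>

lemma backward_induct:
  assumes "P i" "\<And>i. P (Suc i) \<Longrightarrow> P i" "\<And>i. P i \<Longrightarrow> P (i + m)"
  shows "P j"
proof -
  have "P (i + k * m)" for k
    by (induction k) (use assms in \<open>simp_all add: add.assoc[symmetric] add.commute[of m]\<close>)
  moreover have "j \<le> i + j * m" using period(1) by (simp add: trans_le_add2)
  ultimately show ?thesis
    using assms(2) by (metis inc_induct)
qed

lemma gt_1: "1 < s i"
proof -
  \<comment> \<open>Since \<open>2 * m\<close> is at least 2, the shifted index has two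
    predecessors.\<close>
  have "i + 2 * m = (i + 2 * m - 2) + 2" using period(1) by simp
  then have "s i = s ((i + 2 * m - 2) + 2)" by (metis period_mult)
  moreover have "1 < s (j + 2)" for j
    using subprime_next_divisor[OF pos[of j] pos[of "j + 1"]]
    by (metis recurrence dual_order.strict_trans1 prime_gt_1_nat)
  ultimately show ?thesis by metis
qed

text \<open>With all terms above 1, the even prime 2 is never a sum, so every even sum is
  halved.\<close>

lemma divisor:
  "\<exists>q. q * s (i + 2) = s i + s (i + 1) \<and>
     (q = 1 \<and> prime (s (i + 2)) \<or> prime q \<and> q \<le> s (i + 2)) \<and>
     (even (s i + s (i + 1)) \<longrightarrow> q = 2)"
proof -
  have "s i + s (i + 1) \<noteq> 2" using gt_1[of i] gt_1[of "i + 1"] by linarith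
  then show ?thesis
    using subprime_next_divisor[OF pos[of i] pos[of "i + 1"]] unfolding recurrence by simp
qed

text \<open>Otherwise every term is at most the mean of its two predecessors, so the maximum propagates
  backwards around the cycle.\<close>

lemma ex_growth: "\<exists>i. s i + s (i + 1) < 2 * s (i + 2)"
proof (rule ccontr)
  assume "\<not> ?thesis"
  then have mean: "2 * s (i + 2) \<le> s i + s (i + 1)" for i by (simp add: not_less)
  define M where "M = Max (s ` {..<m})"
  have le: "s i \<le> M" for i
    unfolding M_def using period(1)
    by (subst period_mod[symmetric]) (auto intro!: Max_ge)
  have "M \<in> s ` {..<m}" unfolding M_def using period(1) by (intro Max_in) auto
  then obtain i where i: "s i = M" by auto
  have max: "s i = M" "s (i + 1) = M" if "s (i + 2) = M" for i
    using mean[of i] le[of i] le[of "i + 1"] that by linarith+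
  have "s (i + 2 * m - 2 + 2) = M"
  proof -
    have "i + 2 * m - 2 + 2 = i + 2 * m" using period(1) by simp
    then show ?thesis using period_mult[of i 2] i by simp
  qed
  then have last: "s (i + 2 * m - 2) = M \<and> s (i + 2 * m - 2 + 1) = M"
    using max by blast
  have "s j = M \<and> s (j + 1) = M" for j
  proof (rule backward_induct[where P = "\<lambda>j. s j = M \<and> s (j + 1) = M", OF last])
    show "s k = M \<and> s (k + 1) = M" if "s (Suc k) = M \<and> s (Suc k + 1) = M" for k
      using max[of k] that by simp
    show "s (k + m) = M \<and> s (k + m + 1) = M" if "s k = M \<and> s (k + 1) = M" for k
      using that period(2)[of k] period(2)[of "k + 1"] by simp
  qed
  then show False using nonconstant by metis
qed

text \<open>A common prime factor \<open>p\<close> of two neighbours propagates backwards to all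
  terms. At a growth the new term is a prime sum, hence equal to \<open>p\<close>, yet both summands
  are at least \<open>p\<close>.\<close>

lemma coprime_step: "coprime (s i) (s (i + 1))"
proof (rule ccontr)
  assume "\<not> ?thesis"
  then have "gcd (s i) (s (i + 1)) \<noteq> 1" by (simp add: coprime_iff_gcd_eq_1)
  then obtain p where "prime p" "p dvd gcd (s i) (s (i + 1))" using prime_factor_nat by blast
  then have p: "prime p" "p dvd s i" "p dvd s (i + 1)" by simp_all
  have "p dvd s j \<and> p dvd s (j + 1)" for j
  proof (rule backward_induct[where P = "\<lambda>j. p dvd s j \<and> p dvd s (j + 1)"])
    show "p dvd s i \<and> p dvd s (i + 1)" using p by simp
    show "p dvd s j \<and> p dvd s (j + 1)" if "p dvd s (Suc j) \<and> p dvd s (Suc j + 1)" for j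
    proof -
      obtain q where "q * s (j + 2) = s j + s (j + 1)" using divisor[of j] by blast
      then show ?thesis using that
        by (metis Suc_eq_plus1 add_2_eq_Suc' dvd_add_left_iff dvd_mult)
    qed
    show "p dvd s (j + m) \<and> p dvd s (j + m + 1)" if "p dvd s j \<and> p dvd s (j + 1)" for j
      using that period(2)[of j] period(2)[of "j + 1"] by (simp add: add.commute)
  qed
  then have all: "p dvd s j" for j by blast
  obtain j where j: "s j + s (j + 1) < 2 * s (j + 2)" using ex_growth by blast
  obtain q where q: "q * s (j + 2) = s j + s (j + 1)"
    "q = 1 \<and> prime (s (j + 2)) \<or> prime q \<and> q \<le> s (j + 2)" using divisor[of j] by blast
  have "q < 2" using j unfolding q(1)[symmetric] by simp
  then have "prime (s (j + 2))" "s (j + 2) = s j + s (j + 1)"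
    using q prime_ge_2_nat[of q] by auto
  then have "p = s j + s (j + 1)"
    using all[of "j + 2"] p(1) by (metis primes_dvd_imp_eq)
  moreover have "p \<le> s j" "p \<le> s (j + 1)"
    using all pos by (auto intro: dvd_imp_le)
  ultimately show False using pos[of j] by linarith
qed

text \<open>If all terms were odd, each would be the mean of its two predecessors, and none could
  exceed it.\<close>

lemma ex_even: "\<exists>i. even (s i)"
proof (rule ccontr)
  assume "\<nexists>i. even (s i)"
  then have e: "even (s i + s (i + 1))" for i by simp
  obtain j where j: "s j + s (j + 1) < 2 * s (j + 2)" using ex_growth by blast
  obtain q where "q * s (j + 2) = s j + s (j + 1)" "even (s j + s (j + 1)) \<Longrightarrow> q = 2"
    using divisor[of j] by blast
  then show False using e j by simp
qed

lemma odd_after_even: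
  assumes "even (s i)"
  shows "odd (s (i + 1))" "odd (s (i + 2))"
proof -
  show 1: "odd (s (i + 1))"
    using coprime_step[of i] assms coprime_common_divisor[of _ _ 2] by fastforce
  obtain q where "q * s (i + 2) = s i + s (i + 1)" using divisor[of i] by blast
  then show "odd (s (i + 2))"
    using 1 assms by (metis even_add even_mult_iff)
qed

lemma even_spacing:
  assumes "even (s i)" "even (s j)" "i < j"
  shows "i + 3 \<le> j"
  using odd_after_even[OF assms(1)] assms(2,3)
  by (metis Suc_eq_plus1 Suc_leI add_2_eq_Suc' eval_nat_numeral(3) le_neq_implies_less add_Suc_right)

text \<open>The run occupies the indices \<open>e + 1\<close> to \<open>e + n\<close>;
  \<open>e\<close> belongs to the even term before it.\<close>

definition run :: "nat \<Rightarrow> nat \<Rightarrow> bool" where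
  "run e n \<longleftrightarrow> 0 < n \<and> even (s e) \<and> even (s (e + n)) \<and> (\<forall>j. 0 < j \<and> j < n \<longrightarrow> odd (s (e + j)))"

end

section \<open>Runs\<close>

text \<open>Consecutive Jacobsthal numbers, with sum \<open>2 ^ k\<close>; they solve the recurrence
  in which each term is the mean of the two before.\<close>

fun jacobsthal_pair :: "nat \<Rightarrow> int \<times> int" where
  "jacobsthal_pair 0 = (0, 1)"
| "jacobsthal_pair (Suc k) = (case jacobsthal_pair k of (A, B) \<Rightarrow> (B, 2 * A + B))"

lemma jacobsthal_pair_in_run_coeffs:
  assumes "3 \<le> n" "n \<le> 8"
  shows "jacobsthal_pair (n - 2) \<in> set run_coeffs"
proof -
  have "n = 3 \<or> n = 4 \<or> n = 5 \<or> n = 6 \<or> n = 7 \<or> n = 8" using assms by linarith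
  then show ?thesis
    by (elim disjE) (simp_all add: run_coeffs_def numeral_eq_Suc)
qed

context subprime_cycle
begin

text \<open>Two odd neighbours have an even sum, which is halved. The second conjunct carries the
  sum needed for the next mean.\<close>

lemma run_means:
  assumes "run e n" "k + 2 \<le> n" "jacobsthal_pair k = (A, B)"
  shows "(A + B) * int (s (e + k + 2)) = A * int (s (e + 1)) + B * int (s (e + 2)) \<and>
    (A + B) * (int (s (e + k + 1)) + int (s (e + k + 2))) =
      B * int (s (e + 1)) + (2 * A + B) * int (s (e + 2))"
  using assms(2,3)
proof (induction k arbitrary: A B)
  case (Suc k)
  obtain C D where CD: "jacobsthal_pair k = (C, D)" by (cases "jacobsthal_pair k")
  then have AB: "A = D" "B = 2 * C + D" using Suc.prems by auto
  have IH: "(C + D) * int (s (e + k + 2)) = C * int (s (e + 1)) + D * int (s (e + 2))"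
    "(C + D) * (int (s (e + k + 1)) + int (s (e + k + 2))) =
      D * int (s (e + 1)) + (2 * C + D) * int (s (e + 2))"
    using Suc.IH[OF _ CD] Suc.prems by auto
  have "odd (s (e + j))" if "0 < j" "j < n" for j
    using assms(1) that by (simp add: run_def)
  from this[of "k + 1"] this[of "k + 2"] have "odd (s (e + (k + 1)))" "odd (s (e + (k + 2)))"
    using Suc.prems(1) by simp_all
  moreover obtain q where "q * s (e + k + 1 + 2) = s (e + k + 1) + s (e + k + 1 + 1)"
    "even (s (e + k + 1) + s (e + k + 1 + 1)) \<Longrightarrow> q = 2"
    using divisor[of "e + k + 1"] by blast
  ultimately have "2 * s (e + Suc k + 2) = s (e + k + 1) + s (e + k + 2)"
    by (simp add: add.assoc)
  then have "2 * int (s (e + Suc k + 2)) = int (s (e + k + 1)) + int (s (e + k + 2))"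
    by linarith
  then have "(C + D) * (2 * int (s (e + Suc k + 2))) =
      (C + D) * (int (s (e + k + 1)) + int (s (e + k + 2)))"
    by simp
  then show ?case
    using IH unfolding AB by (simp add: algebra_simps)
qed simp

text \<open>The two sums formed with the even term at the end of the run are odd, so both divisors
  are odd.\<close>

lemma run_links:
  assumes "run e n" "jacobsthal_pair (n - 2) = (A, B)"
  obtains q r :: int where
    "links (A, B) q r (int (s (e + 1))) (int (s (e + 2)))
      (int (s (e + n + 1))) (int (s (e + n + 2)))"
    "0 < q" "0 < r" "odd q" "odd r"
    "\<not> illegal q (int (s (e + n + 1)))" "\<not> illegal r (int (s (e + n + 2)))"
proof -
  have n: "3 \<le> n" using even_spacing[of e "e + n"] assms(1) by (auto simp: run_def)
  have means: "(A + B) * int (s (e + n)) = A * int (s (e + 1)) + B * int (s (e + 2))"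
    "(A + B) * (int (s (e + n - 1)) + int (s (e + n))) =
      B * int (s (e + 1)) + (2 * A + B) * int (s (e + 2))"
  proof -
    have "e + (n - 2) + 1 = e + n - 1" "e + (n - 2) + 2 = e + n" using n by simp_all
    then show "(A + B) * int (s (e + n)) = A * int (s (e + 1)) + B * int (s (e + 2))"
      "(A + B) * (int (s (e + n - 1)) + int (s (e + n))) =
        B * int (s (e + 1)) + (2 * A + B) * int (s (e + 2))"
      using run_means[OF assms(1) _ assms(2)] n by simp_all
  qed
  obtain q where q: "q * s (e + n - 1 + 2) = s (e + n - 1) + s (e + n - 1 + 1)"
    "q = 1 \<and> prime (s (e + n - 1 + 2)) \<or> prime q \<and> q \<le> s (e + n - 1 + 2)"
    using divisor[of "e + n - 1"] by blast
  have q': "q * s (e + n + 1) = s (e + n - 1) + s (e + n)"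
    "q = 1 \<and> prime (s (e + n + 1)) \<or> prime q \<and> q \<le> s (e + n + 1)"
    using q n by simp_all
  obtain r where r: "r * s (e + n + 2) = s (e + n) + s (e + n + 1)"
    "r = 1 \<and> prime (s (e + n + 2)) \<or> prime r \<and> r \<le> s (e + n + 2)"
    using divisor[of "e + n"] by blast
  have par: "even (s (e + n))" "odd (s (e + (n - 1)))"
  proof -
    have "odd (s (e + j))" if "0 < j" "j < n" for j
      using assms(1) that by (simp add: run_def)
    from this[of "n - 1"] n show "odd (s (e + (n - 1)))" by simp
  qed (use assms(1) in \<open>simp add: run_def\<close>)
  then have "odd (s (e + n + 1))" using odd_after_even by blast
  have "odd (q * s (e + n + 1))" "odd (r * s (e + n + 2))"
    unfolding q'(1) r(1) using par \<open>odd (s (e + n + 1))\<close> n by simp_all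
  then have odd: "odd q" "odd r" by simp_all
  have legal: "\<not> illegal (int x) (int (s i))" if "x = 1 \<and> prime (s i) \<or> prime x \<and> x \<le> s i" for x i
  proof -
    have "\<not> (p < s i \<and> p dvd s i)" if "prime (s i)" "p \<noteq> 1" for p
      using that by (auto simp: prime_nat_iff)
    from this[of 3] this[of 7]
    have "\<not> (3 < int (s i) \<and> 3 dvd int (s i) \<or> 7 < int (s i) \<and> 7 dvd int (s i))" if "prime (s i)"
      using that int_dvd_int_iff[of 3 "s i"] int_dvd_int_iff[of 7 "s i"] by simp
    then show ?thesis
      using that gt_1[of i] prime_gt_1_nat[of x] unfolding illegal_def by force
  qed
  have eqs: "int q * int (s (e + n + 1)) = int (s (e + n - 1)) + int (s (e + n))"
    "int r * int (s (e + n + 2)) = int (s (e + n)) + int (s (e + n + 1))"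
    using q'(1) r(1) by (metis of_nat_add of_nat_mult)+
  have "links (A, B) (int q) (int r)
      (int (s (e + 1))) (int (s (e + 2))) (int (s (e + n + 1))) (int (s (e + n + 2)))"
    unfolding links_def split mult.assoc eqs
    using means by (simp add: distrib_left)
  moreover have "0 < q" "0 < r" using odd by (auto intro: Nat.gr0I)
  ultimately show ?thesis
    using that[of "int q" "int r"] odd legal q'(2) r(2) by simp
qed

text \<open>The two runs may coincide, so this also covers one run traversed twice.\<close>

lemma no_two_short_runs:
  assumes "run e n" "run (e + n) n'" "n \<le> 8" "n' \<le> 8" "\<And>i. s (e + n + n' + i) = s (e + i)"
  shows False
proof -
  obtain A B A' B' where AB: "jacobsthal_pair (n - 2) = (A, B)" "jacobsthal_pair (n' - 2) = (A', B')"
    by fastforce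
  have "3 \<le> n" "3 \<le> n'"
    using even_spacing[of e "e + n"] even_spacing[of "e + n" "e + n + n'"] assms(1,2)
    by (auto simp: run_def)
  then have coeffs: "(A, B) \<in> set run_coeffs" "(A', B') \<in> set run_coeffs"
    using jacobsthal_pair_in_run_coeffs assms(3,4) AB by metis+
  then have AB_pos: "0 < A" "0 < B" "0 < A'" "0 < B'" by (auto simp: run_coeffs_def)
  obtain q r where qr:
    "links (A, B) q r (int (s (e + 1))) (int (s (e + 2)))
      (int (s (e + n + 1))) (int (s (e + n + 2)))"
    "0 < q" "0 < r" "odd q" "odd r"
    "\<not> illegal q (int (s (e + n + 1)))" "\<not> illegal r (int (s (e + n + 2)))"
    using run_links[OF assms(1) AB(1)] .
  obtain q' r' where qr':
    "links (A', B') q' r' (int (s (e + n + 1))) (int (s (e + n + 2)))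
      (int (s (e + 1))) (int (s (e + 2)))"
    "0 < q'" "0 < r'" "odd q'" "odd r'"
    "\<not> illegal q' (int (s (e + 1)))" "\<not> illegal r' (int (s (e + 2)))"
    using run_links[OF assms(2) AB(2)] unfolding assms(5) .
  have "coprime (int (s (e + 1))) (int (s (e + 2)))"
    using coprime_step[of "e + 1"] by simp
  then interpret two_run_cycle A B A' B' q r q' r'
      "int (s (e + 1))" "int (s (e + 2))" "int (s (e + n + 1))" "int (s (e + n + 2))"
    using AB_pos qr qr' by unfold_locales
  show False using not_run_coeffs coeffs .
qed

section \<open>Positions of the even terms within one period\<close>

abbreviation evens :: "nat set" where
  "evens \<equiv> {i. i < m \<and> even (s i)}"

text \<open>The last hypothesis keeps each even position \<open>k\<close> and its translate
  \<open>k + m\<close> out of the open interval from \<open>i\<close> to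
  \<open>i + n\<close>.\<close>

lemma odd_run:
  assumes "i < m" "n \<le> m" "0 < j" "j < n"
    and "\<And>k. k \<in> evens \<Longrightarrow> k \<le> i \<and> i + n \<le> k + m \<or> i + n \<le> k"
  shows "odd (s (i + j))"
proof
  assume "even (s (i + j))"
  then have "(i + j) mod m \<in> evens" using period by (simp add: period_mod)
  moreover have "(i + j) mod m = (if i + j < m then i + j else i + j - m)"
    using assms by (simp add: le_mod_geq)
  ultimately show False
    using assms(1-4) assms(5)[of "(i + j) mod m"] by (auto split: if_splits)
qed

lemma no_single_run:
  assumes "card evens = 1" "m \<le> 8"
  shows False
proof -
  obtain i where i: "evens = {i}" using assms(1) card_1_singletonE by blast
  then have "i < m" "even (s i)" by auto
  then have "odd (s (i + j))" if "0 < j" "j < m" for j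
    using that by (intro odd_run[of i m j]) (use i in \<open>auto\<close>)
  then have "run i m"
    using \<open>even (s i)\<close> period by (simp add: run_def)
  moreover have "run (i + m) m"
  proof -
    have "s (i + m + j) = s (i + j)" for j
      using period(2)[of "i + j"] by (simp add: ac_simps)
    then show ?thesis
      using \<open>run i m\<close> period(2) by (simp add: run_def)
  qed
  moreover have "s (i + m + m + k) = s (i + k)" for k
  proof -
    have "i + m + m + k = i + k + 2 * m" by simp
    then show ?thesis by (simp only: period_mult)
  qed
  ultimately show False
    using no_two_short_runs[of i m m] assms(2) by simp
qed

lemma no_double_run:
  assumes "card evens = 2" "m \<le> 11"
  shows False
proof -
  obtain i j where ij: "evens = {i, j}" "i < j"
    using assms(1) by (auto simp: card_2_iff) (metis insert_commute linorder_neqE_nat)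
  then have m: "i < m" "j < m" and even: "even (s i)" "even (s j)" "even (s (i + m))"
    using period(2) by auto
  have evens_cases: "k = i \<or> k = j" if "k \<in> evens" for k
    using that ij(1) by blast
  have space: "i + 3 \<le> j" "j + 3 \<le> i + m"
    using even_spacing even m ij(2) by simp_all
  have "odd (s (i + k))" if "0 < k" "k < j - i" for k
  proof (rule odd_run[OF m(1) _ that])
    show "l \<le> i \<and> i + (j - i) \<le> l + m \<or> i + (j - i) \<le> l" if "l \<in> evens" for l
      using evens_cases[OF that] m ij(2) by auto
  qed (use m in simp)
  then have "run i (j - i)"
    using even ij(2) by (simp add: run_def)
  moreover have "odd (s (j + k))" if "0 < k" "k < i + m - j" for k
  proof (rule odd_run[OF m(2) _ that])
    show "l \<le> j \<and> j + (i + m - j) \<le> l + m \<or> j + (i + m - j) \<le> l" if "l \<in> evens" for l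
      using evens_cases[OF that] m ij(2) by auto
  qed (use ij(2) in simp)
  then have "run (i + (j - i)) (i + m - j)"
    using even ij(2) m by (simp add: run_def)
  moreover have "s (i + (j - i) + (i + m - j) + k) = s (i + k)" for k
  proof -
    have "i + (j - i) + (i + m - j) + k = i + k + m" using ij(2) m by simp
    then show ?thesis using period(2) by metis
  qed
  \<comment> \<open>Each run leaves at most 11 - 3 terms for the other.\<close>
  moreover have "j - i \<le> 8" "i + m - j \<le> 8" using space assms(2) by linarith+
  ultimately show False using no_two_short_runs by blast
qed

text \<open>Even positions are at least 3 apart, also across the end of the period, so three of them
  need 9 places.\<close>

lemma card_evens_bounds:
  shows "card evens \<noteq> 0" and "3 \<le> card evens \<Longrightarrow> 9 \<le> m"
proof -
  obtain i where "even (s i)" using ex_even by blast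
  then have "i mod m \<in> evens" using period by (simp add: period_mod)
  then show "card evens \<noteq> 0" by auto
  assume "3 \<le> card evens"
  then obtain S where "S \<subseteq> evens" "card S = 3"
    by (meson obtain_subset_with_card_n)
  then obtain x y z where xyz: "x \<in> evens" "y \<in> evens" "z \<in> evens" "x \<noteq> y" "y \<noteq> z" "x \<noteq> z"
    by (auto simp: card_3_iff)
  have space: "i < j \<longrightarrow> i + 3 \<le> j \<and> j + 3 \<le> i + m" if "i \<in> evens" "j \<in> evens" for i j
    using that even_spacing[of i j] even_spacing[of j "i + m"] period(2) by auto
  show "9 \<le> m"
    using space[of x y] space[of y x] space[of y z] space[of z y] space[of x z] space[of z x] xyz
    by linarith
qed

end

section \<open>From tuples to periodic sequences\<close>

lemma nontrivial_cycle_subprime_cycle: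
  assumes "nontrivial_cycle m t"
  shows "subprime_cycle (\<lambda>i. t ! (i mod m)) m"
proof
  show m: "0 < m" using assms by (auto simp: nontrivial_cycle_def)
  show "t ! ((i + m) mod m) = t ! (i mod m)" for i by simp
  show "0 < t ! (i mod m)" for i using assms m by (simp add: nontrivial_cycle_def)
  show "t ! ((i + 2) mod m) = subprime_next (t ! (i mod m)) (t ! ((i + 1) mod m))" for i
  proof -
    have "t ! ((i mod m + 2) mod m) = subprime_next (t ! (i mod m)) (t ! ((i mod m + 1) mod m))"
      using assms m by (simp add: nontrivial_cycle_def)
    then show ?thesis by (simp only: mod_add_left_eq)
  qed
  show "\<exists>i j. t ! (i mod m) \<noteq> t ! (j mod m)"
    using assms unfolding nontrivial_cycle_def by (metis mod_less)
qed

lemma num_runs_eq_card: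
  assumes "nontrivial_cycle m t"
  shows "num_runs t = card {i. i < m \<and> even (t ! (i mod m))}"
proof -
  have "length t = m" using assms by (simp add: nontrivial_cycle_def)
  then show ?thesis unfolding num_runs_def
    by (intro arg_cong[of _ _ card] Collect_cong) auto
qed

theorem theorem17:
  shows "(\<nexists>m t. m \<le> 8 \<and> nontrivial_cycle m t) \<and>
         (\<nexists>m t. m \<le> 11 \<and> nontrivial_cycle m t \<and> num_runs t = 2)"
proof (intro conjI notI; elim exE conjE)
  fix m t assume m: "m \<le> 8" and t: "nontrivial_cycle m t"
  interpret subprime_cycle "\<lambda>i. t ! (i mod m)" m
    using t by (rule nontrivial_cycle_subprime_cycle)
  have "card evens = 1 \<or> card evens = 2"
    using card_evens_bounds m by linarith
  then show False
    using no_single_run no_double_run m by auto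
next
  fix m t assume m: "m \<le> 11" and t: "nontrivial_cycle m t" and "num_runs t = 2"
  interpret subprime_cycle "\<lambda>i. t ! (i mod m)" m
    using t by (rule nontrivial_cycle_subprime_cycle)
  show False
    using no_double_run \<open>num_runs t = 2\<close> m num_runs_eq_card[OF t] by simp
qed

end
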